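(* Let $d\ge1$, $m=5$ and $M=2$. Let $\{S^i_j\}_{1\le i\le d,\,j=1,2}$ be jointly Gaussian real random variables and let $c_1,c_2,R_{11},R_{12}=R_{21},R_{22}$ be real numbers with $c_1+c_2=1$, $E[S^i_j]=0$ and $E[S^i_jS^{i'}_{j'}]=R_{jj'}\delta_{ii'}$ for $i,i'=1,\dots,d$ and $j,j'=1,2$. Put $Z_j=c_jv_0+\sum_{i=1}^dS^i_jv_i$ for $j=1,2$. Then $$E\left[j_5\left(\exp(Z_1)\exp(Z_2)\right)\right]=j_5\left(\exp\left(v_0+\tfrac12\sum_{i=1}^dv_i^2\right)\right)$$ holds if and only if, for some $u\ge 1/2$ and some choice of sign (the upper signs being taken throughout or the lower signs being taken throughout), $$c_1=\frac{\mp\sqrt{2(2u-1)}}{2},\quad c_2=1\pm\frac{\sqrt{2(2u-1)}}{2},\quad R_{11}=u,\quad R_{22}=1+u\pm\sqrt{2(2u-1)},\quad R_{12}=-u\mp\frac{\sqrt{2(2u-1)}}{2}.$$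
   Context: $A=\{v_0,v_1,\dots,v_d\}$ is an alphabet of non-commuting letters, $A^*$ the set of words over $A$ (including the empty word $1$). $\mathbb R\langle\langle A\rangle\rangle$ is the algebra of formal series $\sum_{w\in A^*}a_ww$ with real coefficients and concatenation product; expectations of random series are taken coefficientwise. For $w=v_{i_1}\cdots v_{i_n}$, $\|w\|=n+\mathrm{card}\{k:i_k=0\}$, and $j_m(\sum_wa_ww)=\sum_{\|w\|\le m}a_ww$. For a series $P$ with zero constant term, $\exp(P)=1+\sum_{k\ge1}P^k/k!$. *)

theory Defs
  imports "HOL-Probability.Probability"
begin

section \<open>Formal series in non-commuting letters\<close>

typedef 'a ncseries = "UNIV :: ('a list \<Rightarrow> real) set"
  morphisms nc_coeff Abs_ncseries ..

lemma nc_coeff_Abs [simp]: "nc_coeff (Abs_ncseries f) = f"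
  by (simp add: Abs_ncseries_inverse)

lemma ncseries_eqI: "(\<And>w. nc_coeff P w = nc_coeff Q w) \<Longrightarrow> P = Q"
  by (metis ext nc_coeff_inject)

instantiation ncseries :: (type) real_algebra_1
begin

definition zero_ncseries :: "'a ncseries" where
  "0 = Abs_ncseries (\<lambda>w. 0)"

definition one_ncseries :: "'a ncseries" where
  "1 = Abs_ncseries (\<lambda>w. if w = [] then 1 else 0)"

definition plus_ncseries :: "'a ncseries \<Rightarrow> 'a ncseries \<Rightarrow> 'a ncseries" where
  "P + Q = Abs_ncseries (\<lambda>w. nc_coeff P w + nc_coeff Q w)"

definition uminus_ncseries :: "'a ncseries \<Rightarrow> 'a ncseries" where
  "- P = Abs_ncseries (\<lambda>w. - nc_coeff P w)"

definition minus_ncseries :: "'a ncseries \<Rightarrow> 'a ncseries \<Rightarrow> 'a ncseries" where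
  "P - Q = Abs_ncseries (\<lambda>w. nc_coeff P w - nc_coeff Q w)"

definition scaleR_ncseries :: "real \<Rightarrow> 'a ncseries \<Rightarrow> 'a ncseries" where
  "r *\<^sub>R P = Abs_ncseries (\<lambda>w. r * nc_coeff P w)"

text \<open>Concatenation product: the sum runs over all ways of cutting \<open>w\<close> in two.\<close>

definition times_ncseries :: "'a ncseries \<Rightarrow> 'a ncseries \<Rightarrow> 'a ncseries" where
  "P * Q = Abs_ncseries
     (\<lambda>w. \<Sum>k\<le>length w. nc_coeff P (take k w) * nc_coeff Q (drop k w))"

instance
proof
  fix P Q R :: "'a ncseries" and a b :: real
  show "P * Q * R = P * (Q * R)"
  proof (rule ncseries_eqI)
    fix w :: "'a list"
    let ?n = "length w"
    let ?f = "\<lambda>l k. nc_coeff P (take l w) * nc_coeff Q (drop l (take k w)) * nc_coeff R (drop k w)"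
    have "nc_coeff (P * Q * R) w = (\<Sum>k\<le>?n. \<Sum>l\<le>k. ?f l k)"
      by (auto simp: times_ncseries_def sum_distrib_right min_def intro!: sum.cong)
    also have "\<dots> = (\<Sum>(k, l)\<in>Sigma {..?n} (\<lambda>k. {..k}). ?f l k)"
      by (subst sum.Sigma) auto
    also have "\<dots> = (\<Sum>(l, m)\<in>Sigma {..?n} (\<lambda>l. {..?n - l}). ?f l (l + m))"
      by (rule sum.reindex_bij_witness[where i = "\<lambda>(l, m). (l + m, l)" and j = "\<lambda>(k, l). (l, k - l)"])
        auto
    also have "\<dots> = (\<Sum>l\<le>?n. \<Sum>m\<le>?n - l. ?f l (l + m))"
      by (subst sum.Sigma) auto
    also have "\<dots> = nc_coeff (P * (Q * R)) w"
      by (auto simp: times_ncseries_def sum_distrib_left drop_take mult.assoc add.commute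
          intro!: sum.cong)
    finally show "nc_coeff (P * Q * R) w = nc_coeff (P * (Q * R)) w" .
  qed
  have one_mult: "1 * P = P" for P :: "'a ncseries"
  proof (rule ncseries_eqI)
    fix w :: "'a list"
    have "nc_coeff (1 * P) w = (\<Sum>k\<le>length w. if k = 0 then nc_coeff P w else 0)"
      unfolding times_ncseries_def one_ncseries_def nc_coeff_Abs
      by (intro sum.cong refl) auto
    then show "nc_coeff (1 * P) w = nc_coeff P w" by simp
  qed
  have mult_one: "P * 1 = P" for P :: "'a ncseries"
  proof (rule ncseries_eqI)
    fix w :: "'a list"
    have "nc_coeff (P * 1) w = (\<Sum>k\<le>length w. if k = length w then nc_coeff P w else 0)"
      unfolding times_ncseries_def one_ncseries_def nc_coeff_Abs
      by (intro sum.cong refl) auto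
    then show "nc_coeff (P * 1) w = nc_coeff P w" by simp
  qed
  show "1 * P = P" "P * 1 = P" by (fact one_mult mult_one)+
  have "nc_coeff (0 :: 'a ncseries) [] \<noteq> nc_coeff 1 []"
    by (simp add: zero_ncseries_def one_ncseries_def)
  then show "(0 :: 'a ncseries) \<noteq> 1" by metis
qed (auto simp: zero_ncseries_def plus_ncseries_def uminus_ncseries_def minus_ncseries_def
    scaleR_ncseries_def times_ncseries_def algebra_simps sum.distrib sum_distrib_left
    intro!: ncseries_eqI)

end

definition nc_letter :: "'a \<Rightarrow> 'a ncseries" where
  "nc_letter x = Abs_ncseries (\<lambda>w. if w = [x] then 1 else 0)"

text \<open>The constant \<^term>\<open>exp\<close> needs a complete norm, so the exponential is defined
  coefficientwise.  If \<open>P\<close> has zero constant term, only the terms with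
  \<open>k \<le> length w\<close> contribute to the coefficient of \<open>w\<close>.\<close>

definition nc_exp :: "'a ncseries \<Rightarrow> 'a ncseries" where
  "nc_exp P = 1 + Abs_ncseries (\<lambda>w. \<Sum>k. nc_coeff (P ^ Suc k /\<^sub>R fact (Suc k)) w)"

text \<open>From here on the letter \<open>v\<^sub>i\<close> is the natural number \<open>i\<close>.  The algebra of series over
  \<open>{v\<^sub>0, \<dots>, v\<^sub>d}\<close> is the subalgebra of \<^typ>\<open>nat ncseries\<close> of those series whose coefficients
  vanish on words containing a letter beyond \<open>v\<^sub>d\<close>.\<close>

definition word_weight :: "nat list \<Rightarrow> nat" where
  "word_weight w = length w + card {k. k < length w \<and> w ! k = 0}"

definition nc_trunc :: "nat \<Rightarrow> nat ncseries \<Rightarrow> nat ncseries" where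
  "nc_trunc m P = Abs_ncseries (\<lambda>w. if word_weight w \<le> m then nc_coeff P w else 0)"

definition nc_expectation :: "'w measure \<Rightarrow> ('w \<Rightarrow> 'a ncseries) \<Rightarrow> 'a ncseries" where
  "nc_expectation M P = Abs_ncseries (\<lambda>w. prob_space.expectation M (\<lambda>\<omega>. nc_coeff (P \<omega>) w))"

section \<open>Jointly Gaussian families\<close>

text \<open>Degenerate (almost surely constant) variables count as Gaussian, as is needed for
  families with a singular covariance matrix.\<close>

definition gaussian_rv :: "'w measure \<Rightarrow> ('w \<Rightarrow> real) \<Rightarrow> bool" where
  "gaussian_rv M X \<longleftrightarrow> X \<in> borel_measurable M \<and>
     (\<exists>\<mu>. (AE \<omega> in M. X \<omega> = \<mu>) \<or>
          (\<exists>\<sigma>>0. distributed M lborel X (normal_density \<mu> \<sigma>)))"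

definition jointly_gaussian :: "'w measure \<Rightarrow> 'i set \<Rightarrow> ('i \<Rightarrow> 'w \<Rightarrow> real) \<Rightarrow> bool" where
  "jointly_gaussian M I X \<longleftrightarrow>
     (\<forall>J a. finite J \<and> J \<subseteq> I \<longrightarrow> gaussian_rv M (\<lambda>\<omega>. \<Sum>i\<in>J. a i * X i \<omega>))"

end

theory Submission
  imports Defs
begin

text \<open>
  The coefficient of \<open>exp L\<close> at a word \<open>x\<^sub>1 \<dots> x\<^sub>n\<close>, for a linear form \<open>L\<close>, is the product of
  the coordinates of \<open>L\<close> at \<open>x\<^sub>1, \<dots>, x\<^sub>n\<close> divided by \<open>n!\<close> (\<open>linear_form_exp\<close>).  Hence the expected
  coefficient of \<open>exp(Z\<^sub>1) exp(Z\<^sub>2)\<close> at \<open>w\<close> is a sum over the cuts \<open>w = uv\<close> of mixed Gaussian moments,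
  with \<open>Z\<^sub>1\<close> read along \<open>u\<close> and \<open>Z\<^sub>2\<close> along \<open>v\<close>.  On the other side, the coefficients of the powers of
  \<open>v\<^sub>0 + (1/2) \<Sum>v\<^sub>i\<^sup>2\<close> are read off by removing a leading \<open>0\<close> or a leading square \<open>ii\<close> from the word.

  Both sides vanish at words with an odd number of nonzero letters: on the left because odd
  moments of centred Gaussians vanish (\<open>odd_moment_eq_0\<close>), on the right because nonzero letters come
  in squares.  In weight at most \<open>5\<close> this leaves the words
  \<open>1, 0, 00, ij, 0ij, i0j, ij0, ijkl\<close> with nonzero \<open>i, j, k, l\<close>.

  At \<open>1, 0, 00\<close> the two sides agree because \<open>c\<^sub>1 + c\<^sub>2 = 1\<close>.  The words \<open>ii, 0ii, ii0\<close> give three equations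
  for \<open>c\<^sub>1, R\<^sub>1\<^sub>1, R\<^sub>1\<^sub>2, R\<^sub>2\<^sub>2\<close>, whose solutions form a curve with parameter \<open>c\<^sub>1\<close> (\<open>moment_equations\<close>):
  \<open>R\<^sub>1\<^sub>1 = c\<^sub>1\<^sup>2 + 1/2\<close>, \<open>R\<^sub>1\<^sub>2 = c\<^sub>1 - c\<^sub>1\<^sup>2 - 1/2\<close>, \<open>R\<^sub>2\<^sub>2 = c\<^sub>1\<^sup>2 - 2c\<^sub>1 + 3/2\<close>.
  The stated family is the same curve, parametrized by \<open>u = R\<^sub>1\<^sub>1\<close> and the sign of \<open>-c\<^sub>1\<close>
  (\<open>sign_parametrization_iff\<close>).

  On this curve the other words impose nothing.  For \<open>i0i\<close>, the three coefficients at \<open>0ii, i0i, ii0\<close>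
  add up to \<open>c\<^sub>1 + c\<^sub>2\<close> times the one at \<open>ii\<close>, that is to \<open>1/2\<close>, and those at \<open>0ii\<close> and \<open>ii0\<close> are \<open>1/4\<close>.  For
  four letters, Isserlis' formula reduces everything to the patterns \<open>iijj\<close>, \<open>ijij\<close>, \<open>ijji\<close> with \<open>i \<noteq> j\<close>:
  the last two have the same coefficient, and the coefficient at \<open>iiii\<close> is the sum of the three.
  The three coefficients at \<open>iijj, ijij, ijji\<close> add up to \<open>(R\<^sub>1\<^sub>1 + 2R\<^sub>1\<^sub>2 + R\<^sub>2\<^sub>2)\<^sup>2/8 = 1/8\<close>, and those at \<open>iijj\<close>
  and \<open>ijij\<close> differ by \<open>(R\<^sub>1\<^sub>1R\<^sub>2\<^sub>2 - R\<^sub>1\<^sub>2\<^sup>2)/4\<close>, which is \<open>1/8\<close> on the curve; so they are \<open>1/8\<close> and \<open>0\<close>, as required.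
\<close>

section \<open>Exponentials of formal series\<close>

lemma nc_coeff_zero [simp]: "nc_coeff 0 w = 0"
  by (simp add: zero_ncseries_def)

lemma nc_coeff_one: "nc_coeff 1 w = (if w = [] then 1 else 0)"
  by (simp add: one_ncseries_def)

lemma nc_coeff_add [simp]: "nc_coeff (P + Q) w = nc_coeff P w + nc_coeff Q w"
  by (simp add: plus_ncseries_def)

lemma nc_coeff_scaleR [simp]: "nc_coeff (r *\<^sub>R P) w = r * nc_coeff P w"
  by (simp add: scaleR_ncseries_def)

lemma nc_coeff_sum [simp]: "nc_coeff (\<Sum>i\<in>I. P i) w = (\<Sum>i\<in>I. nc_coeff (P i) w)"
  by (induction I rule: infinite_finite_induct) auto

lemma nc_coeff_letter: "nc_coeff (nc_letter x) w = (if w = [x] then 1 else 0)"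
  by (simp add: nc_letter_def)

lemma nc_coeff_mult:
  "nc_coeff (P * Q) w = (\<Sum>k\<le>length w. nc_coeff P (take k w) * nc_coeff Q (drop k w))"
  by (simp add: times_ncseries_def)

lemma nc_coeff_mult_Nil [simp]: "nc_coeff (P * Q) [] = nc_coeff P [] * nc_coeff Q []"
  by (simp add: nc_coeff_mult)

text \<open>Homogeneity of degree one; the coordinate of \<open>P\<close> at the letter \<open>x\<close> is then \<open>nc_coeff P [x]\<close>.  Infinitely
  many letters may occur.\<close>

definition linear_form :: "'a ncseries \<Rightarrow> bool" where
  "linear_form P \<longleftrightarrow> (\<forall>w. length w \<noteq> 1 \<longrightarrow> nc_coeff P w = 0)"

lemma linear_form_letter: "linear_form (nc_letter x)"
  by (simp add: linear_form_def nc_coeff_letter)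

text \<open>Multiplication by a linear form can only consume the first letter of a word, which turns the
  product into a recursion along the word.\<close>

lemma linear_form_mult_Cons:
  assumes "linear_form P"
  shows "nc_coeff (P * Q) (x # w) = nc_coeff P [x] * nc_coeff Q w"
proof -
  have "nc_coeff (P * Q) (x # w)
      = (\<Sum>k\<le>Suc (length w). if k = 1 then nc_coeff P [x] * nc_coeff Q w else 0)"
    unfolding nc_coeff_mult length_Cons
  proof (intro sum.cong refl)
    fix k assume "k \<in> {..Suc (length w)}"
    then have "length (take k (x # w)) = k" by (cases k) auto
    then show "nc_coeff P (take k (x # w)) * nc_coeff Q (drop k (x # w))
        = (if k = 1 then nc_coeff P [x] * nc_coeff Q w else 0)"
      using assms unfolding linear_form_def by (cases "k = 1") auto
  qed
  then show ?thesis by (simp add: sum.delta del: sum.atMost_Suc)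
qed

lemma linear_form_power:
  assumes "linear_form P"
  shows "nc_coeff (P ^ k) w = (if length w = k then \<Prod>x\<leftarrow>w. nc_coeff P [x] else 0)"
proof (induction k arbitrary: w)
  case 0
  then show ?case by (simp add: nc_coeff_one)
next
  case (Suc k)
  have "nc_coeff P [] = 0"
    using assms by (simp add: linear_form_def)
  then show ?case
    by (cases w) (simp_all add: linear_form_mult_Cons[OF assms] Suc.IH)
qed

text \<open>Each factor takes at least one letter.  This makes the series defining \<^const>\<open>nc_exp\<close> a
  finite sum at every word.\<close>

lemma nc_coeff_power_eq_0:
  assumes "nc_coeff P [] = 0" and "length w < k"
  shows "nc_coeff (P ^ k) w = 0"
  using assms(2)
proof (induction k arbitrary: w)
  case (Suc k)
  show ?case
    unfolding power_Suc nc_coeff_mult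
  proof (intro sum.neutral ballI)
    fix l assume "l \<in> {..length w}"
    then have "l = 0 \<or> length (drop l w) < k"
      using Suc.prems by auto
    then show "nc_coeff P (take l w) * nc_coeff (P ^ k) (drop l w) = 0"
      using Suc.IH assms(1) by auto
  qed
qed simp

lemma nc_coeff_exp:
  assumes "nc_coeff P [] = 0"
  shows "nc_coeff (nc_exp P) w = (\<Sum>k\<le>length w. nc_coeff (P ^ k) w / fact k)"
proof -
  let ?f = "\<lambda>k. nc_coeff (P ^ k) w / fact k"
  have "(\<Sum>k. nc_coeff (P ^ Suc k /\<^sub>R fact (Suc k)) w)
      = (\<Sum>k<length w. nc_coeff (P ^ Suc k /\<^sub>R fact (Suc k)) w)"
    by (rule suminf_finite) (auto simp: nc_coeff_power_eq_0[OF assms] simp del: power_Suc)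
  also have "\<dots> = (\<Sum>k<length w. ?f (Suc k))"
    by (intro sum.cong refl) (simp only: nc_coeff_scaleR divide_inverse mult.commute)
  finally have "nc_coeff (nc_exp P) w = ?f 0 + (\<Sum>k<length w. ?f (Suc k))"
    by (simp add: nc_exp_def del: power_Suc)
  also have "\<dots> = (\<Sum>k<Suc (length w). ?f k)"
    by (simp only: sum.lessThan_Suc_shift)
  finally show ?thesis by (simp only: lessThan_Suc_atMost)
qed

lemma linear_form_exp:
  assumes "linear_form P"
  shows "nc_coeff (nc_exp P) w = (\<Prod>x\<leftarrow>w. nc_coeff P [x]) / fact (length w)"
proof -
  have "nc_coeff P [] = 0"
    using assms by (simp add: linear_form_def)
  then have "nc_coeff (nc_exp P) w
      = (\<Sum>k\<le>length w. if k = length w then (\<Prod>x\<leftarrow>w. nc_coeff P [x]) / fact k else 0)"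
    unfolding nc_coeff_exp[OF \<open>nc_coeff P [] = 0\<close>]
    by (intro sum.cong refl) (auto simp: linear_form_power[OF assms])
  then show ?thesis by simp
qed

lemma linear_form_exp_mult_exp:
  assumes "linear_form P" "linear_form Q"
  shows "nc_coeff (nc_exp P * nc_exp Q) w
    = (\<Sum>k\<le>length w. (\<Prod>x\<leftarrow>take k w. nc_coeff P [x]) * (\<Prod>x\<leftarrow>drop k w. nc_coeff Q [x])
          / (fact k * fact (length w - k)))"
  unfolding nc_coeff_mult
  by (intro sum.cong refl) (simp add: linear_form_exp[OF assms(1)] linear_form_exp[OF assms(2)])

section \<open>The exponential of the generator\<close>

text \<open>In the cubature interpretation, where \<open>v\<^sub>0\<close> is the drift and \<open>v\<^sub>1, \<dots>, v\<^sub>d\<close> are the diffusion vector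
  fields, this is the generator of the diffusion.\<close>

definition generator :: "nat \<Rightarrow> nat ncseries" where
  "generator d = nc_letter 0 + (1/2) *\<^sub>R (\<Sum>i = 1..d. nc_letter i ^ 2)"

lemma generator_Nil: "nc_coeff (generator d) [] = 0"
  by (simp add: generator_def nc_coeff_letter power2_eq_square)

text \<open>The first letter of a word decides whether its first block is \<open>0\<close> or \<open>ii\<close>, so of all the cuts in the
  product only one contributes.\<close>

lemma generator_mult_Cons:
  "nc_coeff (generator d * Q) (x # w)
    = (if x = 0 then nc_coeff Q w
       else case w of [] \<Rightarrow> 0 | y # v \<Rightarrow> if y = x \<and> x \<le> d then nc_coeff Q v / 2 else 0)"
proof -
  have pair: "nc_coeff (nc_letter i ^ 2 * Q) (x # w)
      = (if i = x then case w of [] \<Rightarrow> 0 | y # v \<Rightarrow> if y = x then nc_coeff Q v else 0 else 0)" for i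
    by (cases w) (auto simp: power2_eq_square mult.assoc linear_form_mult_Cons[OF linear_form_letter]
        nc_coeff_letter)
  have "nc_coeff (generator d * Q) (x # w) = nc_coeff (nc_letter 0 * Q) (x # w)
      + (\<Sum>i = 1..d. nc_coeff (nc_letter i ^ 2 * Q) (x # w)) / 2"
    by (simp add: generator_def distrib_right sum_distrib_right)
  also have "\<dots> = (if x = 0 then nc_coeff Q w
       else case w of [] \<Rightarrow> 0 | y # v \<Rightarrow> if y = x \<and> x \<le> d then nc_coeff Q v / 2 else 0)"
    unfolding pair
    by (auto simp: linear_form_mult_Cons[OF linear_form_letter] nc_coeff_letter split: list.split)
  finally show ?thesis .
qed

lemma generator_power_Suc_Cons:
  "nc_coeff (generator d ^ Suc k) (x # w)
    = (if x = 0 then nc_coeff (generator d ^ k) w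
       else case w of [] \<Rightarrow> 0
         | y # v \<Rightarrow> if y = x \<and> x \<le> d then nc_coeff (generator d ^ k) v / 2 else 0)"
  by (simp only: power_Suc generator_mult_Cons)

lemma generator_Cons:
  "nc_coeff (generator d) (x # w)
    = (if x = 0 then if w = [] then 1 else 0 else if w = [x] \<and> x \<le> d then 1 / 2 else 0)"
  using generator_mult_Cons[of d 1 x w] by (auto simp: nc_coeff_one split: list.splits)

lemma generator_power_Nil: "nc_coeff (generator d ^ Suc k) [] = 0"
  by (simp add: generator_Nil)

text \<open>Every letter of a word in the support lies in a block \<open>0\<close> or \<open>ii\<close> with \<open>i \<le> d\<close>.\<close>

lemma generator_power_support:
  "nc_coeff (generator d ^ k) w \<noteq> 0 \<Longrightarrow>
     set w \<subseteq> {..d} \<and> even (length (filter (\<lambda>x. x \<noteq> 0) w))"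
proof (induction k arbitrary: w)
  case 0
  then show ?case by (simp add: nc_coeff_one split: if_splits)
next
  case (Suc k)
  show ?case
  proof (cases w)
    case Nil
    then show ?thesis using Suc.prems generator_power_Nil by simp
  next
    case (Cons x v)
    then show ?thesis
      using Suc.prems Suc.IH[of v] Suc.IH[of "tl v"]
      by (auto simp: generator_power_Suc_Cons simp del: power_Suc split: if_splits list.splits)
  qed
qed

lemma exp_generator_eq_0:
  assumes "\<not> set w \<subseteq> {..d} \<or> odd (length (filter (\<lambda>x. x \<noteq> 0) w))"
  shows "nc_coeff (nc_exp (generator d)) w = 0"
proof -
  have "nc_coeff (generator d ^ k) w = 0" for k
    using assms generator_power_support by blast
  then show ?thesis by (simp add: nc_coeff_exp[OF generator_Nil])
qed

section \<open>Words of weight at most five\<close>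

lemma word_weight_eq: "word_weight w = length w + length (filter (\<lambda>x. x = 0) w)"
  by (simp add: word_weight_def length_filter_conv_card)

lemma word_weight_Nil [simp]: "word_weight [] = 0"
  by (simp add: word_weight_eq)

lemma word_weight_Cons [simp]: "word_weight (x # w) = (if x = 0 then 2 else 1) + word_weight w"
  by (simp add: word_weight_eq)

lemma word_weight_eq_0 [simp]: "word_weight w = 0 \<longleftrightarrow> w = []"
  by (auto simp: word_weight_eq)

text \<open>With \<open>a\<close> zeros and \<open>b\<close> nonzero letters the weight is \<open>2a + b\<close>, so an even \<open>b\<close> is \<open>0\<close> with \<open>a \<le> 2\<close>,
  \<open>2\<close> with \<open>a \<le> 1\<close>, or \<open>4\<close> with \<open>a = 0\<close>.\<close>

lemma even_words_weight_le_5: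
  assumes "word_weight w \<le> 5" and "even (length (filter (\<lambda>x. x \<noteq> 0) w))"
  obtains "w = []" | "w = [0]" | "w = [0, 0]"
    | i j where "i \<noteq> 0" "j \<noteq> 0" "w = [i, j]"
    | i j where "i \<noteq> 0" "j \<noteq> 0" "w = [0, i, j]"
    | i j where "i \<noteq> 0" "j \<noteq> 0" "w = [i, 0, j]"
    | i j where "i \<noteq> 0" "j \<noteq> 0" "w = [i, j, 0]"
    | i j k l where "i \<noteq> 0" "j \<noteq> 0" "k \<noteq> 0" "l \<noteq> 0" "w = [i, j, k, l]"
proof -
  have split: "v = [] \<or> (\<exists>x u. v = x # u)" for v :: "nat list"
    by (cases v) auto
  consider "w = []" | x where "w = [x]" | x y where "w = [x,y]" | x y z where "w = [x,y,z]"
    | x y z t where "w = [x,y,z,t]" | x y z t s v where "w = x#y#z#t#s#v"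
    by (metis split)
  then show thesis
    by cases (use assms that in \<open>auto split: if_splits\<close>)
qed

lemma exp_generator_scalar:
  "nc_coeff (nc_exp (generator d)) [] = 1"
  "nc_coeff (nc_exp (generator d)) [0] = 1"
  "nc_coeff (nc_exp (generator d)) [0, 0] = 1 / 2"
  by (auto simp: nc_coeff_exp[OF generator_Nil] generator_power_Suc_Cons nc_coeff_one
      generator_Nil generator_Cons generator_power_Nil numeral_2_eq_2 simp del: power_Suc)

lemma exp_generator_2:
  assumes "i \<noteq> 0" "i \<le> d" "j \<noteq> 0"
  shows "nc_coeff (nc_exp (generator d)) [i, j] = (if i = j then 1 / 2 else 0)"
    "nc_coeff (nc_exp (generator d)) [0, i, j] = (if i = j then 1 / 4 else 0)"
    "nc_coeff (nc_exp (generator d)) [i, 0, j] = 0"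
    "nc_coeff (nc_exp (generator d)) [i, j, 0] = (if i = j then 1 / 4 else 0)"
  using assms
  by (auto simp: nc_coeff_exp[OF generator_Nil] generator_power_Suc_Cons nc_coeff_one
      generator_Nil generator_Cons generator_power_Nil numeral_2_eq_2 simp del: power_Suc)

lemma exp_generator_4:
  assumes "i \<noteq> 0" "i \<le> d" "j \<noteq> 0" "k \<noteq> 0" "k \<le> d" "l \<noteq> 0"
  shows "nc_coeff (nc_exp (generator d)) [i, j, k, l] = of_bool (i = j \<and> k = l) / 8"
  using assms
  by (auto simp: nc_coeff_exp[OF generator_Nil] generator_power_Suc_Cons nc_coeff_one
      generator_Nil generator_Cons generator_power_Nil numeral_2_eq_2 simp del: power_Suc)

section \<open>Moments of Gaussian spaces\<close>

lemma (in prob_space) centered_gaussian_cases: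
  assumes "gaussian_rv M X" and "expectation X = 0"
  obtains "AE \<omega> in M. X \<omega> = 0"
    | \<sigma> where "\<sigma> > 0" "distributed M lborel X (normal_density 0 \<sigma>)"
proof -
  from assms(1) obtain \<mu> where X: "X \<in> borel_measurable M" and
    "(AE \<omega> in M. X \<omega> = \<mu>) \<or> (\<exists>\<sigma>>0. distributed M lborel X (normal_density \<mu> \<sigma>))"
    unfolding gaussian_rv_def by blast
  then consider "AE \<omega> in M. X \<omega> = \<mu>"
    | \<sigma> where "\<sigma> > 0" "distributed M lborel X (normal_density \<mu> \<sigma>)"
    by blast
  then show thesis
  proof cases
    case 1
    then have "expectation X = expectation (\<lambda>_. \<mu>)"
      using X by (intro integral_cong_AE) auto
    then have "\<mu> = 0" using assms(2) by (simp add: prob_space)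
    then show thesis using 1 that(1) by simp
  next
    case 2
    then have "\<mu> = 0" using normal_distributed_expectation assms(2) by metis
    then show thesis using 2 that(2) by simp
  qed
qed

text \<open>The fourth moment is expressed through the variance so that degenerate variables obey the same
  formula; this is what makes polarization over a linear space possible.\<close>

lemma (in prob_space) centered_gaussian_moments:
  assumes X: "gaussian_rv M X" "expectation X = 0"
  shows "integrable M (\<lambda>\<omega>. X \<omega> ^ n)"
    and "odd n \<Longrightarrow> expectation (\<lambda>\<omega>. X \<omega> ^ n) = 0"
    and "expectation (\<lambda>\<omega>. X \<omega> ^ 4) = 3 * (expectation (\<lambda>\<omega>. X \<omega> ^ 2))\<^sup>2"
proof -
  have [measurable]: "X \<in> borel_measurable M"
    using X(1) by (simp add: gaussian_rv_def)
  have "integrable M (\<lambda>\<omega>. X \<omega> ^ n) \<and> (odd n \<longrightarrow> expectation (\<lambda>\<omega>. X \<omega> ^ n) = 0)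
      \<and> expectation (\<lambda>\<omega>. X \<omega> ^ 4) = 3 * (expectation (\<lambda>\<omega>. X \<omega> ^ 2))\<^sup>2"
    using X
  proof (cases rule: centered_gaussian_cases)
    case 1
    have ae: "AE \<omega> in M. X \<omega> ^ m = 0 ^ m" for m
      using 1 by eventually_elim simp
    have e: "expectation (\<lambda>\<omega>. X \<omega> ^ m) = 0 ^ m" for m
    proof -
      have "expectation (\<lambda>\<omega>. X \<omega> ^ m) = expectation (\<lambda>_. 0 ^ m)"
        by (intro integral_cong_AE ae) auto
      then show ?thesis by (simp add: prob_space)
    qed
    have "integrable M (\<lambda>\<omega>. X \<omega> ^ n) \<longleftrightarrow> integrable M (\<lambda>_. 0 ^ n :: real)"
      by (intro integrable_cong_AE ae) auto
    then show ?thesis by (auto simp: e odd_pos zero_power)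
  next
    case (2 \<sigma>)
    have "integrable M (\<lambda>\<omega>. X \<omega> ^ m)" for m
      using distributed_integrable[OF 2(2), of "\<lambda>x. x ^ m"] integrable_normal_moment[OF 2(1), of 0 m]
      by simp
    moreover have e: "expectation (\<lambda>\<omega>. X \<omega> ^ m) = (\<integral>x. normal_density 0 \<sigma> x * x ^ m \<partial>lborel)" for m
      using distributed_integral[OF 2(2), of "\<lambda>x. x ^ m"] by simp
    moreover have "odd n \<longrightarrow> expectation (\<lambda>\<omega>. X \<omega> ^ n) = 0"
      using integral_normal_moment_odd[OF 2(1), of 0] by (auto simp: e elim!: oddE)
    moreover have "expectation (\<lambda>\<omega>. X \<omega> ^ 4) = 3 * \<sigma> ^ 4"
      using integral_normal_moment_even[OF 2(1), of 0 2] 2(1)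
      unfolding e by (simp add: fact_numeral power2_eq_square power4_eq_xxxx mult.assoc)
    moreover have "expectation (\<lambda>\<omega>. X \<omega> ^ 2) = \<sigma>\<^sup>2"
      using integral_normal_moment_even[OF 2(1), of 0 1] 2(1)
      unfolding e by (simp add: fact_numeral power2_eq_square)
    ultimately show ?thesis by simp
  qed
  then show "integrable M (\<lambda>\<omega>. X \<omega> ^ n)" "odd n \<Longrightarrow> expectation (\<lambda>\<omega>. X \<omega> ^ n) = 0"
    "expectation (\<lambda>\<omega>. X \<omega> ^ 4) = 3 * (expectation (\<lambda>\<omega>. X \<omega> ^ 2))\<^sup>2"
    by blast+
qed

text \<open>Having all moments is closed under products, unlike integrability; it justifies
  interchanging expectation and finite sums of products.\<close>

definition has_moments :: "'w measure \<Rightarrow> ('w \<Rightarrow> real) \<Rightarrow> bool" where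
  "has_moments M f \<longleftrightarrow> f \<in> borel_measurable M \<and> (\<forall>p. integrable M (\<lambda>\<omega>. f \<omega> ^ p))"

lemma has_moments_integrable: "has_moments M f \<Longrightarrow> integrable M f"
  unfolding has_moments_def by (metis (no_types, lifting) ext power_one_right)

text \<open>By \<open>\<bar>xy\<bar> \<le> x\<^sup>2 + y\<^sup>2\<close>, the moment of order \<open>p\<close> of the product is controlled by the moments of order
  \<open>2p\<close> of the factors.\<close>

lemma has_moments_mult:
  assumes "has_moments M f" "has_moments M g"
  shows "has_moments M (\<lambda>\<omega>. f \<omega> * g \<omega>)"
  unfolding has_moments_def
proof safe
  have [measurable]: "f \<in> borel_measurable M" "g \<in> borel_measurable M"
    using assms by (auto simp: has_moments_def)
  show "(\<lambda>\<omega>. f \<omega> * g \<omega>) \<in> borel_measurable M" by simp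
  fix p
  have "integrable M (\<lambda>\<omega>. f \<omega> ^ (p * 2) + g \<omega> ^ (p * 2))"
    using assms by (auto simp: has_moments_def)
  then show "integrable M (\<lambda>\<omega>. (f \<omega> * g \<omega>) ^ p)"
  proof (rule Bochner_Integration.integrable_bound)
    have "\<bar>x * y\<bar> \<le> \<bar>x\<^sup>2 + y\<^sup>2\<bar>" for x y :: real
    proof -
      have "2 * \<bar>x\<bar> * \<bar>y\<bar> \<le> \<bar>x\<bar>\<^sup>2 + \<bar>y\<bar>\<^sup>2"
        by (rule sum_squares_bound)
      moreover have "0 \<le> \<bar>x\<bar> * \<bar>y\<bar>"
        by simp
      ultimately show ?thesis unfolding abs_mult power2_abs by linarith
    qed
    then show "AE \<omega> in M. norm ((f \<omega> * g \<omega>) ^ p) \<le> norm (f \<omega> ^ (p * 2) + g \<omega> ^ (p * 2))"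
      by (simp add: power_mult_distrib power_mult)
  qed measurable
qed

lemma (in prob_space) has_moments_const: "has_moments M (\<lambda>_. a)"
  by (simp add: has_moments_def)

lemma (in prob_space) has_moments_power:
  "has_moments M f \<Longrightarrow> has_moments M (\<lambda>\<omega>. f \<omega> ^ n)"
  by (induction n) (auto intro: has_moments_mult has_moments_const)

lemma (in prob_space) has_moments_prod_list:
  "(\<And>f. f \<in> set fs \<Longrightarrow> has_moments M f) \<Longrightarrow> has_moments M (\<lambda>\<omega>. \<Prod>f\<leftarrow>fs. f \<omega>)"
  by (induction fs) (auto intro: has_moments_mult has_moments_const)

text \<open>A linear space of centred Gaussian variables.  Joint moments of its members follow from moments
  of single members by polarization.\<close>

locale gaussian_space = prob_space +
  fixes V :: "('a \<Rightarrow> real) set"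
  assumes gaussian: "X \<in> V \<Longrightarrow> gaussian_rv M X"
    and centered: "X \<in> V \<Longrightarrow> expectation X = 0"
    and add_mem: "X \<in> V \<Longrightarrow> Y \<in> V \<Longrightarrow> (\<lambda>\<omega>. X \<omega> + Y \<omega>) \<in> V"
    and scale_mem: "X \<in> V \<Longrightarrow> (\<lambda>\<omega>. t * X \<omega>) \<in> V"
begin

lemma mem_has_moments: "X \<in> V \<Longrightarrow> has_moments M X"
  using centered_gaussian_moments(1)[OF gaussian centered] gaussian
  by (auto simp: has_moments_def gaussian_rv_def)

text \<open>A product is split off one factor at a time: since \<open>X + tY\<close> stays in the space, the expectation of
  \<open>(X + tY)\<^sup>n\<^sup>+\<^sup>1 P\<close> vanishes for all \<open>t\<close>, and then so does the coefficient of \<open>t\<close> of this polynomial, which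
  is \<open>n + 1\<close> times the expectation of \<open>X\<^sup>n Y P\<close>.\<close>

lemma expectation_pow_mult_prod_list_eq_0:
  assumes "X \<in> V" "set Ys \<subseteq> V" "odd (n + length Ys)"
  shows "expectation (\<lambda>\<omega>. X \<omega> ^ n * (\<Prod>Y\<leftarrow>Ys. Y \<omega>)) = 0"
  using assms
proof (induction Ys arbitrary: X n)
  case Nil
  then show ?case
    using centered_gaussian_moments(2)[OF gaussian centered] by simp
next
  case (Cons Y Ys)
  let ?P = "\<lambda>\<omega>. \<Prod>Y\<leftarrow>Ys. Y \<omega>"
  let ?c = "\<lambda>k. real (Suc n choose k) * expectation (\<lambda>\<omega>. Y \<omega> ^ k * X \<omega> ^ (Suc n - k) * ?P \<omega>)"
  have int: "integrable M (\<lambda>\<omega>. Y \<omega> ^ k * X \<omega> ^ l * ?P \<omega>)" for k l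
    using Cons.prems
    by (intro has_moments_integrable has_moments_mult has_moments_power has_moments_prod_list
        mem_has_moments) auto
  have "(\<Sum>k\<le>Suc n. ?c k * t ^ k) = 0" for t
  proof -
    have mem: "(\<lambda>\<omega>. t * Y \<omega> + X \<omega>) \<in> V"
      using Cons.prems by (intro add_mem scale_mem) auto
    have "(t * Y \<omega> + X \<omega>) ^ Suc n * ?P \<omega>
        = (\<Sum>k\<le>Suc n. real (Suc n choose k) * t ^ k * (Y \<omega> ^ k * X \<omega> ^ (Suc n - k) * ?P \<omega>))" for \<omega>
      unfolding binomial_ring sum_distrib_right
      by (intro sum.cong refl) (simp add: power_mult_distrib mult_ac)
    then have "expectation (\<lambda>\<omega>. (t * Y \<omega> + X \<omega>) ^ Suc n * ?P \<omega>)
        = (\<Sum>k\<le>Suc n. real (Suc n choose k) * t ^ k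
            * expectation (\<lambda>\<omega>. Y \<omega> ^ k * X \<omega> ^ (Suc n - k) * ?P \<omega>))"
      using int by (simp only: Bochner_Integration.integral_sum integrable_mult_right integral_mult_right_zero)
    moreover have "expectation (\<lambda>\<omega>. (t * Y \<omega> + X \<omega>) ^ Suc n * ?P \<omega>) = 0"
      using Cons.IH[OF mem, of "Suc n"] Cons.prems by simp
    ultimately show ?thesis by (simp add: mult_ac)
  qed
  from zero_polynom_imp_zero_coeffs[of ?c "Suc n" 1, OF this]
  show ?case by (simp add: mult_ac del: of_nat_Suc)
qed

lemma odd_moment_eq_0:
  assumes "set Ys \<subseteq> V" "odd (length Ys)"
  shows "expectation (\<lambda>\<omega>. \<Prod>Y\<leftarrow>Ys. Y \<omega>) = 0"
proof -
  obtain Y where "Y \<in> V" using assms by (cases Ys) auto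
  from expectation_pow_mult_prod_list_eq_0[OF this assms(1), of 0] show ?thesis
    using assms(2) by simp
qed

text \<open>Polarization of \<open>E[L\<^sup>4] = 3 E[L\<^sup>2]\<^sup>2\<close> over the eight combinations \<open>L = X \<plusminus> Y \<plusminus> Z \<plusminus> W\<close>: weighted by the
  product of their three signs, the fourth powers add up to \<open>8 \<cdot> 4! = 192\<close> times \<open>XYZW\<close>.\<close>

lemma isserlis_4:
  assumes "X \<in> V" "Y \<in> V" "Z \<in> V" "W \<in> V"
  shows "expectation (\<lambda>\<omega>. X \<omega> * Y \<omega> * Z \<omega> * W \<omega>)
    = expectation (\<lambda>\<omega>. X \<omega> * Y \<omega>) * expectation (\<lambda>\<omega>. Z \<omega> * W \<omega>)
    + expectation (\<lambda>\<omega>. X \<omega> * Z \<omega>) * expectation (\<lambda>\<omega>. Y \<omega> * W \<omega>)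
    + expectation (\<lambda>\<omega>. X \<omega> * W \<omega>) * expectation (\<lambda>\<omega>. Y \<omega> * Z \<omega>)"
proof -
  define L where "L b c d = (\<lambda>\<omega>. X \<omega> + b * Y \<omega> + c * Z \<omega> + d * W \<omega>)" for b c d
  let ?E = "\<lambda>X Y. expectation (\<lambda>\<omega>. X \<omega> * Y \<omega>)"
  have L: "L b c d \<in> V" for b c d
    unfolding L_def by (intro add_mem scale_mem assms)
  have [simp]: "integrable M (\<lambda>\<omega>. A \<omega> * B \<omega>)" if "A \<in> V" "B \<in> V" for A B
    using that by (intro has_moments_integrable has_moments_mult mem_has_moments)
  \<comment> \<open>The squares of the signs are \<open>1\<close>, so the diagonal terms enter only through their sum \<open>D\<close>.\<close>
  define D where "D = ?E X X + ?E Y Y + ?E Z Z + ?E W W"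
  define p q r s t u where "p = ?E X Y" and "q = ?E X Z" and "r = ?E X W"
    and "s = ?E Y Z" and "t = ?E Y W" and "u = ?E Z W"
  have var: "expectation (\<lambda>\<omega>. L b c d \<omega> ^ 2)
      = D + 2 * (b * p + c * q + d * r + b * c * s + b * d * t + c * d * u)"
    if "b\<^sup>2 = 1" "c\<^sup>2 = 1" "d\<^sup>2 = 1" for b c d
  proof -
    have "expectation (\<lambda>\<omega>. L b c d \<omega> ^ 2) = expectation (\<lambda>\<omega>. X \<omega> * X \<omega> + b\<^sup>2 * (Y \<omega> * Y \<omega>)
      + c\<^sup>2 * (Z \<omega> * Z \<omega>) + d\<^sup>2 * (W \<omega> * W \<omega>)
      + 2 * (b * (X \<omega> * Y \<omega>) + c * (X \<omega> * Z \<omega>) + d * (X \<omega> * W \<omega>) + b * c * (Y \<omega> * Z \<omega>)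
          + b * d * (Y \<omega> * W \<omega>) + c * d * (Z \<omega> * W \<omega>)))"
      unfolding L_def by (intro Bochner_Integration.integral_cong refl) algebra
    then show ?thesis
      using assms that by (simp add: D_def p_def q_def r_def s_def t_def u_def)
  qed
  have signs: "expectation (\<lambda>\<omega>. L 1 1 1 \<omega> ^ 2) = D + 2 * (p + q + r + s + t + u)"
    "expectation (\<lambda>\<omega>. L (-1) 1 1 \<omega> ^ 2) = D + 2 * (- p + q + r - s - t + u)"
    "expectation (\<lambda>\<omega>. L 1 (-1) 1 \<omega> ^ 2) = D + 2 * (p - q + r - s + t - u)"
    "expectation (\<lambda>\<omega>. L 1 1 (-1) \<omega> ^ 2) = D + 2 * (p + q - r + s - t - u)"
    "expectation (\<lambda>\<omega>. L (-1) (-1) 1 \<omega> ^ 2) = D + 2 * (- p - q + r + s - t - u)"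
    "expectation (\<lambda>\<omega>. L (-1) 1 (-1) \<omega> ^ 2) = D + 2 * (- p + q - r - s + t - u)"
    "expectation (\<lambda>\<omega>. L 1 (-1) (-1) \<omega> ^ 2) = D + 2 * (p - q - r - s - t + u)"
    "expectation (\<lambda>\<omega>. L (-1) (-1) (-1) \<omega> ^ 2) = D + 2 * (- p - q - r + s + t + u)"
    by (subst var; simp)+
  have "192 * expectation (\<lambda>\<omega>. X \<omega> * Y \<omega> * Z \<omega> * W \<omega>)
      = expectation (\<lambda>\<omega>. 192 * (X \<omega> * Y \<omega> * Z \<omega> * W \<omega>))"
    by simp
  also have "\<dots> = expectation (\<lambda>\<omega>. L 1 1 1 \<omega> ^ 4 - L (-1) 1 1 \<omega> ^ 4 - L 1 (-1) 1 \<omega> ^ 4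
      - L 1 1 (-1) \<omega> ^ 4 + L (-1) (-1) 1 \<omega> ^ 4 + L (-1) 1 (-1) \<omega> ^ 4 + L 1 (-1) (-1) \<omega> ^ 4
      - L (-1) (-1) (-1) \<omega> ^ 4)"
    unfolding L_def by (intro Bochner_Integration.integral_cong refl) algebra
  also have "\<dots> = expectation (\<lambda>\<omega>. L 1 1 1 \<omega> ^ 4) - expectation (\<lambda>\<omega>. L (-1) 1 1 \<omega> ^ 4)
      - expectation (\<lambda>\<omega>. L 1 (-1) 1 \<omega> ^ 4) - expectation (\<lambda>\<omega>. L 1 1 (-1) \<omega> ^ 4)
      + expectation (\<lambda>\<omega>. L (-1) (-1) 1 \<omega> ^ 4) + expectation (\<lambda>\<omega>. L (-1) 1 (-1) \<omega> ^ 4)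
      + expectation (\<lambda>\<omega>. L 1 (-1) (-1) \<omega> ^ 4) - expectation (\<lambda>\<omega>. L (-1) (-1) (-1) \<omega> ^ 4)"
    using centered_gaussian_moments(1)[OF gaussian centered, OF L L] by simp
  also have "\<dots> = 192 * (p * u + q * t + r * s)"
    unfolding centered_gaussian_moments(3)[OF gaussian centered, OF L L] signs by algebra
  finally show ?thesis by (simp add: p_def q_def r_def s_def t_def u_def)
qed

end

lemma (in prob_space) gaussian_space_of_family:
  fixes X :: "'i \<Rightarrow> 'a \<Rightarrow> real"
  assumes "finite I" and gauss: "jointly_gaussian M I X"
    and mean: "\<And>i. i \<in> I \<Longrightarrow> expectation (X i) = 0"
  shows "gaussian_space M (range (\<lambda>a \<omega>. \<Sum>i\<in>I. a i * X i \<omega>))"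
    and "X ` I \<subseteq> range (\<lambda>a \<omega>. \<Sum>i\<in>I. a i * X i \<omega>)"
proof -
  let ?V = "range (\<lambda>a \<omega>. \<Sum>i\<in>I. a i * X i \<omega>)"
  have int: "integrable M (X i)" if "i \<in> I" for i
  proof -
    have "gaussian_rv M (\<lambda>\<omega>. \<Sum>k\<in>{i}. 1 * X k \<omega>)"
      using gauss[unfolded jointly_gaussian_def, rule_format, of "{i}" "\<lambda>_. 1"] that by simp
    then show ?thesis
      using centered_gaussian_moments(1)[of "X i" 1] mean[OF that] by simp
  qed
  show "gaussian_space M ?V"
  proof
    fix Y Z t assume "Y \<in> ?V"
    then obtain a where Y: "Y = (\<lambda>\<omega>. \<Sum>i\<in>I. a i * X i \<omega>)" by (rule rangeE)
    show "gaussian_rv M Y"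
      using gauss[unfolded jointly_gaussian_def, rule_format, of I a] \<open>finite I\<close> by (simp add: Y)
    show "expectation Y = 0"
      unfolding Y using mean int by simp
    show "(\<lambda>\<omega>. t * Y \<omega>) \<in> ?V"
      by (rule range_eqI[where x = "\<lambda>i. t * a i"]) (simp add: Y sum_distrib_left mult.assoc)
    assume "Z \<in> ?V"
    then obtain b where Z: "Z = (\<lambda>\<omega>. \<Sum>i\<in>I. b i * X i \<omega>)" by (rule rangeE)
    show "(\<lambda>\<omega>. Y \<omega> + Z \<omega>) \<in> ?V"
      by (rule range_eqI[where x = "\<lambda>i. a i + b i"]) (simp add: Y Z sum.distrib distrib_right)
  qed
  show "X ` I \<subseteq> ?V"
  proof safe
    fix i assume "i \<in> I"
    have "(\<Sum>k\<in>I. (if k = i then 1 else 0) * X k \<omega>) = (\<Sum>k\<in>I. if k = i then X k \<omega> else 0)" for \<omega>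
      by (intro sum.cong) auto
    then have "(\<Sum>k\<in>I. (if k = i then 1 else 0) * X k \<omega>) = X i \<omega>" for \<omega>
      using \<open>finite I\<close> \<open>i \<in> I\<close> by simp
    then show "X i \<in> ?V"
      by (intro range_eqI[where x = "\<lambda>k. if k = i then 1 else 0"] ext) (rule sym)
  qed
qed

section \<open>Expected coefficients of the product of exponentials\<close>

locale gaussian_letters = prob_space M for M :: "'w measure" +
  fixes d :: nat and S :: "nat \<Rightarrow> nat \<Rightarrow> 'w \<Rightarrow> real" and c :: "nat \<Rightarrow> real"
    and R :: "nat \<Rightarrow> nat \<Rightarrow> real"
  assumes gauss: "jointly_gaussian M ({1..d} \<times> {1, 2}) (\<lambda>(i, j). S i j)"
    and mean: "\<And>i j. i \<in> {1..d} \<Longrightarrow> j \<in> {1, 2} \<Longrightarrow> expectation (S i j) = 0"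
    and cov: "\<And>i i' j j'. i \<in> {1..d} \<Longrightarrow> i' \<in> {1..d} \<Longrightarrow> j \<in> {1, 2} \<Longrightarrow> j' \<in> {1, 2} \<Longrightarrow>
       expectation (\<lambda>\<omega>. S i j \<omega> * S i' j' \<omega>) = (if i = i' then R j j' else 0)"
begin

abbreviation pairs :: "(nat \<times> nat) set" where
  "pairs \<equiv> {1..d} \<times> {1, 2}"

definition span_S :: "('w \<Rightarrow> real) set" where
  "span_S = range (\<lambda>a \<omega>. \<Sum>p\<in>pairs. a p * (case p of (i, j) \<Rightarrow> S i j) \<omega>)"

sublocale gaussian_space M span_S
  unfolding span_S_def
  by (rule gaussian_space_of_family(1)[OF _ gauss]) (auto intro: mean)

lemma S_in_span: "p \<in> pairs \<Longrightarrow> S (fst p) (snd p) \<in> span_S"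
  using gaussian_space_of_family(2)[OF _ gauss] mean
  unfolding span_S_def by (fastforce simp: image_subset_iff)

text \<open>The coordinate of \<open>Z\<^sub>j\<close> at the letter \<open>v\<^sub>x\<close>, indexed by \<open>(x, j)\<close>.\<close>

definition coordinate :: "nat \<times> nat \<Rightarrow> 'w \<Rightarrow> real" where
  "coordinate = (\<lambda>(x, j) \<omega>. if x = 0 then c j else if x \<le> d then S x j \<omega> else 0)"

definition gauss_moment :: "(nat \<times> nat) list \<Rightarrow> real" where
  "gauss_moment ps = expectation (\<lambda>\<omega>. \<Prod>p\<leftarrow>ps. S (fst p) (snd p) \<omega>)"

definition moment :: "(nat \<times> nat) list \<Rightarrow> real" where
  "moment ps = expectation (\<lambda>\<omega>. \<Prod>p\<leftarrow>ps. coordinate p \<omega>)"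

text \<open>The zeros contribute deterministic factors \<open>c\<^sub>j\<close>, wherever they stand in the word.\<close>

lemma moment_factor:
  assumes "set ps \<subseteq> {..d} \<times> {1, 2}"
  shows "moment ps = (\<Prod>p\<leftarrow>filter (\<lambda>p. fst p = 0) ps. c (snd p))
    * gauss_moment (filter (\<lambda>p. fst p \<noteq> 0) ps)"
proof -
  have "(\<Prod>p\<leftarrow>ps. coordinate p \<omega>) = (\<Prod>p\<leftarrow>filter (\<lambda>p. fst p = 0) ps. c (snd p))
      * (\<Prod>p\<leftarrow>filter (\<lambda>p. fst p \<noteq> 0) ps. S (fst p) (snd p) \<omega>)" for \<omega>
    using assms by (induction ps) (auto simp: coordinate_def)
  then show ?thesis
    by (simp only: moment_def gauss_moment_def integral_mult_right_zero)
qed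

lemma moment_eq_0:
  assumes "\<not> fst ` set ps \<subseteq> {..d}"
  shows "moment ps = 0"
proof -
  have "0 \<in> set (map (\<lambda>p. coordinate p \<omega>) ps)" for \<omega>
    using assms by (force simp: coordinate_def)
  then have "(\<Prod>p\<leftarrow>ps. coordinate p \<omega>) = 0" for \<omega>
    by (metis prod_list_zero_iff)
  then show ?thesis by (simp add: moment_def)
qed

lemma gauss_moment_odd:
  assumes "set ps \<subseteq> pairs" "odd (length ps)"
  shows "gauss_moment ps = 0"
proof -
  have "set (map (\<lambda>p. S (fst p) (snd p)) ps) \<subseteq> span_S"
    using S_in_span assms(1) by auto
  from odd_moment_eq_0[OF this] assms(2) show ?thesis
    by (simp add: gauss_moment_def comp_def)
qed

lemma gauss_moment_Nil: "gauss_moment [] = 1"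
  by (simp add: gauss_moment_def prob_space)

lemma gauss_moment_2:
  assumes "(i, j) \<in> pairs" "(i', j') \<in> pairs"
  shows "gauss_moment [(i, j), (i', j')] = (if i = i' then R j j' else 0)"
  using cov[of i i' j j'] assms by (simp add: gauss_moment_def)

lemma gauss_moment_4:
  assumes "(i, j) \<in> pairs" "(i', j') \<in> pairs" "(k, l) \<in> pairs" "(k', l') \<in> pairs"
  shows "gauss_moment [(i, j), (i', j'), (k, l), (k', l')]
    = of_bool (i = i' \<and> k = k') * (R j j' * R l l') + of_bool (i = k \<and> i' = k') * (R j l * R j' l')
    + of_bool (i = k' \<and> i' = k) * (R j l' * R j' l)"
proof -
  have "gauss_moment [(i, j), (i', j'), (k, l), (k', l')]
    = gauss_moment [(i, j), (i', j')] * gauss_moment [(k, l), (k', l')]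
    + gauss_moment [(i, j), (k, l)] * gauss_moment [(i', j'), (k', l')]
    + gauss_moment [(i, j), (k', l')] * gauss_moment [(i', j'), (k, l)]"
    using isserlis_4[OF assms[THEN S_in_span]] by (simp add: gauss_moment_def mult.assoc)
  also have "gauss_moment [(i, j), (i', j')] * gauss_moment [(k, l), (k', l')]
      = of_bool (i = i' \<and> k = k') * (R j j' * R l l')"
    unfolding gauss_moment_2[OF assms(1,2)] gauss_moment_2[OF assms(3,4)] by simp
  also have "gauss_moment [(i, j), (k, l)] * gauss_moment [(i', j'), (k', l')]
      = of_bool (i = k \<and> i' = k') * (R j l * R j' l')"
    unfolding gauss_moment_2[OF assms(1,3)] gauss_moment_2[OF assms(2,4)] by simp
  also have "gauss_moment [(i, j), (k', l')] * gauss_moment [(i', j'), (k, l)]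
      = of_bool (i = k' \<and> i' = k) * (R j l' * R j' l)"
    unfolding gauss_moment_2[OF assms(1,4)] gauss_moment_2[OF assms(2,3)] by simp
  finally show ?thesis .
qed

lemma has_moments_coordinate:
  assumes "j \<in> {1, 2}"
  shows "has_moments M (coordinate (x, j))"
proof (cases "x \<in> {1..d}")
  case True
  then show ?thesis
    using mem_has_moments[OF S_in_span, of "(x, j)"] assms by (simp add: coordinate_def)
next
  case False
  then have "coordinate (x, j) = (\<lambda>_. if x = 0 then c j else 0)"
    by (auto simp: coordinate_def)
  then show ?thesis by (simp add: has_moments_const)
qed

text \<open>The sum over the cuts of \<open>w\<close>, with \<open>Z\<^sub>1\<close> read before the cut and \<open>Z\<^sub>2\<close> after it.\<close>

definition expected_coeff :: "nat list \<Rightarrow> real" where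
  "expected_coeff w = (\<Sum>k\<le>length w. moment (map (\<lambda>x. (x, 1)) (take k w) @ map (\<lambda>x. (x, 2)) (drop k w))
      / (fact k * fact (length w - k)))"

lemma expectation_coeff_exp_mult_exp:
  assumes Z: "\<And>j \<omega>. j \<in> {1, 2} \<Longrightarrow>
    Z j \<omega> = c j *\<^sub>R nc_letter 0 + (\<Sum>i = 1..d. S i j \<omega> *\<^sub>R nc_letter i)"
  shows "expectation (\<lambda>\<omega>. nc_coeff (nc_exp (Z 1 \<omega>) * nc_exp (Z 2 \<omega>)) w) = expected_coeff w"
proof -
  have lin: "linear_form (Z j \<omega>)" if "j \<in> {1, 2}" for j \<omega>
    using linear_form_letter[where 'a = nat] by (auto simp: Z[OF that] linear_form_def intro!: sum.neutral)
  have coeff: "nc_coeff (Z j \<omega>) [x] = coordinate (x, j) \<omega>" if "j \<in> {1, 2}" for j x \<omega>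
    by (auto simp: Z[OF that] nc_coeff_letter coordinate_def if_distrib[of "\<lambda>a. _ * a"] cong: if_cong)
  let ?ps = "\<lambda>k. map (\<lambda>x. (x, 1)) (take k w) @ map (\<lambda>x. (x, 2)) (drop k w)"
  have eq: "nc_coeff (nc_exp (Z 1 \<omega>) * nc_exp (Z 2 \<omega>)) w
      = (\<Sum>k\<le>length w. (\<Prod>p\<leftarrow>?ps k. coordinate p \<omega>) / (fact k * fact (length w - k)))" for \<omega>
    by (simp add: linear_form_exp_mult_exp[OF lin lin] coeff comp_def)
  have int: "integrable M (\<lambda>\<omega>. \<Prod>p\<leftarrow>?ps k. coordinate p \<omega>)" for k
    using has_moments_prod_list[of "map coordinate (?ps k)"] has_moments_coordinate
    by (intro has_moments_integrable) (auto simp: comp_def)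
  show ?thesis
    unfolding eq expected_coeff_def moment_def using int by (simp del: map_append)
qed

lemma expected_coeff_eq_0:
  assumes "\<not> set w \<subseteq> {..d} \<or> odd (length (filter (\<lambda>x. x \<noteq> 0) w))"
  shows "expected_coeff w = 0"
proof -
  have "moment (map (\<lambda>x. (x, 1)) (take k w) @ map (\<lambda>x. (x, 2)) (drop k w)) = 0"
    (is "moment ?ps = 0") for k
  proof (cases "set w \<subseteq> {..d}")
    case True
    have w: "map fst ?ps = w"
      by (simp add: comp_def)
    have "length (filter (\<lambda>p. fst p \<noteq> 0) ps) = length (filter (\<lambda>x. x \<noteq> 0) (map fst ps))"
      for ps :: "(nat \<times> nat) list"
      by (simp add: filter_map comp_def)
    then have "odd (length (filter (\<lambda>p. fst p \<noteq> 0) ?ps))"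
      using assms True w by metis
    moreover have "set (filter (\<lambda>p. fst p \<noteq> 0) ?ps) \<subseteq> pairs" "set ?ps \<subseteq> {..d} \<times> {1, 2}"
      using True by (auto simp: Suc_le_eq dest: in_set_takeD in_set_dropD)
    ultimately show ?thesis
      using moment_factor gauss_moment_odd by simp
  next
    case False
    have "set (take k w) \<union> set (drop k w) = set w"
      by (metis append_take_drop_id set_append)
    then have "fst ` set ?ps = set w"
      by (simp add: image_Un image_image)
    then show ?thesis using False moment_eq_0 by simp
  qed
  then show ?thesis by (simp only: expected_coeff_def) simp
qed

lemma expected_coeff_scalar:
  "expected_coeff [] = 1"
  "expected_coeff [0] = c 1 + c 2"
  "expected_coeff [0, 0] = (c 1 + c 2)\<^sup>2 / 2"
  by (simp_all add: expected_coeff_def moment_factor gauss_moment_Nil field_simps power2_eq_square)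

lemma expected_coeff_2:
  assumes "i \<in> {1..d}" "j \<in> {1..d}"
  shows "expected_coeff [i, j] = (if i = j then R 1 1 / 2 + R 1 2 + R 2 2 / 2 else 0)"
    "expected_coeff [0, i, j] = (if i = j
       then c 1 * R 1 1 / 6 + c 1 * R 1 2 / 2 + c 1 * R 2 2 / 2 + c 2 * R 2 2 / 6 else 0)"
    "expected_coeff [i, 0, j] = (if i = j
       then c 1 * R 1 1 / 6 + c 1 * R 1 2 / 2 + c 2 * R 1 2 / 2 + c 2 * R 2 2 / 6 else 0)"
    "expected_coeff [i, j, 0] = (if i = j
       then c 1 * R 1 1 / 6 + c 2 * R 1 1 / 2 + c 2 * R 1 2 / 2 + c 2 * R 2 2 / 6 else 0)"
  using assms
  by (simp_all add: expected_coeff_def moment_factor gauss_moment_2 fact_numeral numeral_3_eq_3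
      numeral_2_eq_2)

text \<open>The three pairings of Isserlis' formula contribute separately.  They differ only for the
  cut in the middle, which separates the pairs of \<open>ij|kl\<close> and gives \<open>R\<^sub>1\<^sub>1R\<^sub>2\<^sub>2\<close>, while it splits both pairs
  of the other two pairings and gives \<open>R\<^sub>1\<^sub>2\<^sup>2\<close>.  The remaining cuts add up to the common term \<open>A\<close>.\<close>

lemma expected_coeff_4:
  assumes "i \<in> {1..d}" "j \<in> {1..d}" "k \<in> {1..d}" "l \<in> {1..d}"
  defines "A \<equiv> R 1 1 ^ 2 / 24 + R 1 1 * R 1 2 / 6 + R 1 2 * R 2 2 / 6 + R 2 2 ^ 2 / 24"
  shows "expected_coeff [i, j, k, l] = of_bool (i = j \<and> k = l) * (A + R 1 1 * R 2 2 / 4)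
    + of_bool (i = k \<and> j = l) * (A + R 1 2 ^ 2 / 4) + of_bool (i = l \<and> j = k) * (A + R 1 2 ^ 2 / 4)"
proof -
  \<comment> \<open>As opaque factors the indicators leave an identity linear in them, without case distinctions.\<close>
  define \<alpha> \<beta> \<gamma> :: real where "\<alpha> = of_bool (i = j \<and> k = l)" and "\<beta> = of_bool (i = k \<and> j = l)"
    and "\<gamma> = of_bool (i = l \<and> j = k)"
  have "moment [(i, a), (j, b), (k, e), (l, f)]
      = \<alpha> * (R a b * R e f) + \<beta> * (R a e * R b f) + \<gamma> * (R a f * R b e)"
    if "a \<in> {1, 2}" "b \<in> {1, 2}" "e \<in> {1, 2}" "f \<in> {1, 2}" for a b e f
    using assms(1-4) that moment_factor[of "[(i, a), (j, b), (k, e), (l, f)]"]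
      gauss_moment_4[of i a j b k e l f]
    by (simp add: \<alpha>_def \<beta>_def \<gamma>_def)
  then have "expected_coeff [i, j, k, l]
      = \<alpha> * (A + R 1 1 * R 2 2 / 4) + \<beta> * (A + R 1 2 ^ 2 / 4) + \<gamma> * (A + R 1 2 ^ 2 / 4)"
    by (simp add: expected_coeff_def A_def fact_numeral power2_eq_square field_simps)
  then show ?thesis
    by (simp only: \<alpha>_def \<beta>_def \<gamma>_def)
qed

end

section \<open>Solving the moment equations\<close>

text \<open>On the family, \<open>\<epsilon> * sqrt (2 * (2 * u - 1)) = - 2 * c1\<close>; squaring gives \<open>u = c1\<^sup>2 + 1/2\<close>, and the
  remaining relations are linear.  Conversely this \<open>u\<close> makes the root equal to \<open>\<bar>2 * c1\<bar>\<close>.\<close>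

lemma sign_parametrization_iff:
  fixes c1 c2 R11 R12 R22 :: real
  assumes "c1 + c2 = 1"
  shows "(\<exists>u \<ge> 1/2. \<exists>\<epsilon> \<in> {1, -1}.
            c1 = - \<epsilon> * sqrt (2 * (2 * u - 1)) / 2 \<and>
            c2 = 1 + \<epsilon> * sqrt (2 * (2 * u - 1)) / 2 \<and>
            R11 = u \<and>
            R22 = 1 + u + \<epsilon> * sqrt (2 * (2 * u - 1)) \<and>
            R12 = - u - \<epsilon> * sqrt (2 * (2 * u - 1)) / 2)
    \<longleftrightarrow> R11 = c1\<^sup>2 + 1/2 \<and> R12 = c1 - c1\<^sup>2 - 1/2 \<and> R22 = c1\<^sup>2 - 2 * c1 + 3/2"
    (is "?L \<longleftrightarrow> ?R")
proof
  assume ?L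
  then obtain u \<epsilon> where u: "u \<ge> 1/2" "\<epsilon> = 1 \<or> \<epsilon> = -1"
    "c1 = - \<epsilon> * sqrt (2 * (2 * u - 1)) / 2" "R11 = u"
    "R22 = 1 + u + \<epsilon> * sqrt (2 * (2 * u - 1))"
    "R12 = - u - \<epsilon> * sqrt (2 * (2 * u - 1)) / 2"
    by blast
  have s: "\<epsilon> * sqrt (2 * (2 * u - 1)) = - 2 * c1"
    using u(3) by simp
  have "(2 * c1)\<^sup>2 = \<epsilon>\<^sup>2 * (sqrt (2 * (2 * u - 1)))\<^sup>2"
    using s by (simp flip: power_mult_distrib)
  then have "4 * c1\<^sup>2 = 2 * (2 * u - 1)"
    using u(1,2) by (auto simp: power_mult_distrib)
  then show ?R
    using u(4-6) unfolding s by auto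
next
  assume R: ?R
  define \<epsilon> :: real where "\<epsilon> = (if c1 \<le> 0 then 1 else -1)"
  have "2 * (2 * (c1\<^sup>2 + 1/2) - 1) = (2 * c1)\<^sup>2"
    by (simp add: power_mult_distrib)
  then have "sqrt (2 * (2 * (c1\<^sup>2 + 1/2) - 1)) = \<bar>2 * c1\<bar>"
    by (simp only: real_sqrt_abs)
  then have s: "\<epsilon> * sqrt (2 * (2 * (c1\<^sup>2 + 1/2) - 1)) = - 2 * c1"
    by (simp add: \<epsilon>_def)
  show ?L
  proof (intro exI[of _ "c1\<^sup>2 + 1/2"] conjI bexI[of _ \<epsilon>])
    show "\<epsilon> \<in> {1, -1}"
      by (simp add: \<epsilon>_def)
  qed (use R assms s in auto)
qed

text \<open>The hypotheses after the first are the conditions at the words \<open>ii\<close>, \<open>0ii\<close> and \<open>ii0\<close>.  Although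
  quadratic, they can be solved for the covariances in terms of \<open>c1\<close>: the difference of the last two
  reads \<open>c1 * (R12 + R22) = c2 * (R11 + R12)\<close>, and as both \<open>c1 + c2\<close> and the sum of the two brackets
  are \<open>1\<close>, this means \<open>R11 + R12 = c1\<close>.\<close>

lemma moment_equations:
  fixes c1 c2 R11 R12 R22 :: real
  assumes "c1 + c2 = 1"
    and "R11 / 2 + R12 + R22 / 2 = 1 / 2"
    and "c1 * R11 / 6 + c1 * R12 / 2 + c1 * R22 / 2 + c2 * R22 / 6 = 1 / 4"
    and "c1 * R11 / 6 + c2 * R11 / 2 + c2 * R12 / 2 + c2 * R22 / 6 = 1 / 4"
  shows "R11 = c1\<^sup>2 + 1/2 \<and> R12 = c1 - c1\<^sup>2 - 1/2 \<and> R22 = c1\<^sup>2 - 2 * c1 + 3/2"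
proof -
  have c2: "c2 = 1 - c1" and R22: "R22 = 1 - 2 * R12 - R11"
    using assms(1,2) by simp_all
  have "c1 * (R12 + R22) = c2 * (R11 + R12)"
    using assms(3,4) by (simp add: algebra_simps)
  then have R12: "R12 = c1 - R11"
    by (simp add: c2 R22 algebra_simps)
  have "R11 = c1\<^sup>2 + 1/2"
    using assms(3) by (simp add: c2 R22 R12 field_simps power2_eq_square)
  then show ?thesis
    by (simp add: R22 R12)
qed

text \<open>The conditions at the words \<open>ii, 0ii, i0i, ii0\<close>, and at \<open>iijj\<close> and \<open>ijij\<close> with \<open>i \<noteq> j\<close>.  The last two
  combine \<open>(R11 + 2 * R12 + R22)\<^sup>2 = 1\<close> with the value \<open>1/2\<close> of the determinant of the covariance
  matrix, which is constant along the curve.\<close>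

lemma moment_equations_converse:
  fixes c1 c2 R11 R12 R22 :: real
  assumes c_sum: "c1 + c2 = 1" and R11: "R11 = c1\<^sup>2 + 1/2" and R12: "R12 = c1 - c1\<^sup>2 - 1/2"
    and R22: "R22 = c1\<^sup>2 - 2 * c1 + 3/2"
  shows "R11 / 2 + R12 + R22 / 2 = 1 / 2"
    and "c1 * R11 / 6 + c1 * R12 / 2 + c1 * R22 / 2 + c2 * R22 / 6 = 1 / 4"
    and "c1 * R11 / 6 + c1 * R12 / 2 + c2 * R12 / 2 + c2 * R22 / 6 = 0"
    and "c1 * R11 / 6 + c2 * R11 / 2 + c2 * R12 / 2 + c2 * R22 / 6 = 1 / 4"
    and "R11\<^sup>2 / 24 + R11 * R12 / 6 + R12 * R22 / 6 + R22\<^sup>2 / 24 + R11 * R22 / 4 = 1 / 8"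
    and "R11\<^sup>2 / 24 + R11 * R12 / 6 + R12 * R22 / 6 + R22\<^sup>2 / 24 + R12\<^sup>2 / 4 = 0"
proof -
  have c1_R: "c1 * R11 = c1 ^ 3 + c1 / 2" "c1 * R12 = c1\<^sup>2 - c1 ^ 3 - c1 / 2"
    "c1 * R22 = c1 ^ 3 - 2 * c1\<^sup>2 + 3 * c1 / 2"
    by (simp_all add: R11 R12 R22 algebra_simps power2_eq_square power3_eq_cube)
  have c2_R: "c2 * x = x - c1 * x" for x
    using c_sum by (simp add: algebra_simps flip: distrib_right)
  show sum: "R11 / 2 + R12 + R22 / 2 = 1 / 2"
    and "c1 * R11 / 6 + c1 * R12 / 2 + c1 * R22 / 2 + c2 * R22 / 6 = 1 / 4"
    and "c1 * R11 / 6 + c1 * R12 / 2 + c2 * R12 / 2 + c2 * R22 / 6 = 0"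
    and "c1 * R11 / 6 + c2 * R11 / 2 + c2 * R12 / 2 + c2 * R22 / 6 = 1 / 4"
    using c1_R c2_R[of R11] c2_R[of R12] c2_R[of R22] R11 R12 R22 by linarith+
  have det: "R11 * R22 - R12\<^sup>2 = 1 / 2"
    by (simp add: R11 R12 R22 algebra_simps power2_eq_square)
  have "(R11 + 2 * R12 + R22)\<^sup>2 = 1"
    using sum by (simp add: power2_eq_1_iff)
  then have square: "R11\<^sup>2 + 4 * R12\<^sup>2 + R22\<^sup>2 + 4 * (R11 * R12) + 2 * (R11 * R22) + 4 * (R12 * R22) = 1"
    by (simp add: power2_eq_square algebra_simps)
  show "R11\<^sup>2 / 24 + R11 * R12 / 6 + R12 * R22 / 6 + R22\<^sup>2 / 24 + R11 * R22 / 4 = 1 / 8"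
    and "R11\<^sup>2 / 24 + R11 * R12 / 6 + R12 * R22 / 6 + R22\<^sup>2 / 24 + R12\<^sup>2 / 4 = 0"
    using det square by linarith+
qed

section \<open>The characterization of the cubature formula\<close>

theorem theorem1p6:
  fixes d :: nat
    and M :: "'w measure"
    and S :: "nat \<Rightarrow> nat \<Rightarrow> 'w \<Rightarrow> real"
    and c :: "nat \<Rightarrow> real"
    and R :: "nat \<Rightarrow> nat \<Rightarrow> real"
    and Z :: "nat \<Rightarrow> 'w \<Rightarrow> nat ncseries"
  assumes d: "d \<ge> 1"
    and prob: "prob_space M"
    and gauss: "jointly_gaussian M ({1..d} \<times> {1, 2}) (\<lambda>(i, j). S i j)"
    and c_sum: "c 1 + c 2 = 1"
    and R_sym: "R 1 2 = R 2 1"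
    and mean: "\<And>i j. i \<in> {1..d} \<Longrightarrow> j \<in> {1, 2} \<Longrightarrow> prob_space.expectation M (S i j) = 0"
    and cov: "\<And>i i' j j'. i \<in> {1..d} \<Longrightarrow> i' \<in> {1..d} \<Longrightarrow> j \<in> {1, 2} \<Longrightarrow> j' \<in> {1, 2} \<Longrightarrow>
       prob_space.expectation M (\<lambda>\<omega>. S i j \<omega> * S i' j' \<omega>) = (if i = i' then R j j' else 0)"
    and Z: "\<And>j \<omega>. j \<in> {1, 2} \<Longrightarrow>
       Z j \<omega> = c j *\<^sub>R nc_letter 0 + (\<Sum>i = 1..d. S i j \<omega> *\<^sub>R nc_letter i)"
  shows "nc_expectation M (\<lambda>\<omega>. nc_trunc 5 (nc_exp (Z 1 \<omega>) * nc_exp (Z 2 \<omega>)))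
           = nc_trunc 5 (nc_exp (nc_letter 0 + (1/2) *\<^sub>R (\<Sum>i = 1..d. nc_letter i ^ 2)))
     \<longleftrightarrow> (\<exists>u \<ge> 1/2. \<exists>\<epsilon> \<in> {1, -1}.
            c 1 = - \<epsilon> * sqrt (2 * (2 * u - 1)) / 2 \<and>
            c 2 = 1 + \<epsilon> * sqrt (2 * (2 * u - 1)) / 2 \<and>
            R 1 1 = u \<and>
            R 2 2 = 1 + u + \<epsilon> * sqrt (2 * (2 * u - 1)) \<and>
            R 1 2 = - u - \<epsilon> * sqrt (2 * (2 * u - 1)) / 2)"
proof -
  interpret prob_space M by (rule prob)
  interpret gaussian_letters M d S c R
    using gauss mean cov by unfold_locales auto
  have lhs: "nc_coeff (nc_expectation M (\<lambda>\<omega>. nc_trunc 5 (nc_exp (Z 1 \<omega>) * nc_exp (Z 2 \<omega>)))) w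
      = (if word_weight w \<le> 5 then expected_coeff w else 0)" for w
    using expectation_coeff_exp_mult_exp[OF Z, of w]
    by (simp add: nc_expectation_def nc_trunc_def)
  have rhs: "nc_coeff (nc_trunc 5 (nc_exp (generator d))) w
      = (if word_weight w \<le> 5 then nc_coeff (nc_exp (generator d)) w else 0)" for w
    by (simp add: nc_trunc_def)
  let ?target = "\<lambda>w. nc_coeff (nc_exp (generator d)) w"
  have "nc_expectation M (\<lambda>\<omega>. nc_trunc 5 (nc_exp (Z 1 \<omega>) * nc_exp (Z 2 \<omega>)))
      = nc_trunc 5 (nc_exp (generator d))
    \<longleftrightarrow> (\<forall>w. word_weight w \<le> 5 \<longrightarrow> expected_coeff w = ?target w)" (is "?E \<longleftrightarrow> ?C")
  proof
    assume ?E
    then show ?C using lhs rhs by metis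
  next
    assume ?C
    then have "(if word_weight w \<le> 5 then expected_coeff w else 0)
        = (if word_weight w \<le> 5 then ?target w else 0)" for w
      by presburger
    then show ?E
      unfolding lhs[symmetric] rhs[symmetric] by (rule ncseries_eqI)
  qed
  also have "?C \<longleftrightarrow> R 1 1 = (c 1)\<^sup>2 + 1/2 \<and> R 1 2 = c 1 - (c 1)\<^sup>2 - 1/2
      \<and> R 2 2 = (c 1)\<^sup>2 - 2 * c 1 + 3/2" (is "_ \<longleftrightarrow> ?R")
  proof
    assume C: ?C
    have i: "1 \<in> {1..d}" using d by simp
    have "expected_coeff [1, 1] = ?target [1, 1]" "expected_coeff [0, 1, 1] = ?target [0, 1, 1]"
      "expected_coeff [1, 1, 0] = ?target [1, 1, 0]"
      by (rule C[rule_format]; simp)+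
    then show ?R
      using d moment_equations[OF c_sum, of "R 1 1" "R 1 2" "R 2 2"]
      unfolding expected_coeff_2[OF i i] by (simp add: exp_generator_2)
  next
    assume ?R
    then have "R 1 1 = (c 1)\<^sup>2 + 1/2" "R 1 2 = c 1 - (c 1)\<^sup>2 - 1/2"
      "R 2 2 = (c 1)\<^sup>2 - 2 * c 1 + 3/2"
      by blast+
    note identities = moment_equations_converse[OF c_sum this]
    have two: "expected_coeff [i, j] = (if i = j then 1 / 2 else 0)"
      "expected_coeff [0, i, j] = (if i = j then 1 / 4 else 0)"
      "expected_coeff [i, 0, j] = 0"
      "expected_coeff [i, j, 0] = (if i = j then 1 / 4 else 0)"
      if "i \<in> {1..d}" "j \<in> {1..d}" for i j
      unfolding expected_coeff_2[OF that] identities(1-4) if_cancel by (rule refl)+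
    have four: "expected_coeff [i, j, k, l] = of_bool (i = j \<and> k = l) / 8"
      if "i \<in> {1..d}" "j \<in> {1..d}" "k \<in> {1..d}" "l \<in> {1..d}" for i j k l
      unfolding expected_coeff_4[OF that] identities(5,6) by simp
    show ?C
    proof (intro allI impI)
      fix w assume w: "word_weight w \<le> 5"
      show "expected_coeff w = ?target w"
      proof (cases "set w \<subseteq> {..d} \<and> even (length (filter (\<lambda>x. x \<noteq> 0) w))")
        case False
        then show ?thesis
          by (metis expected_coeff_eq_0 exp_generator_eq_0)
      next
        case True
        then have ev: "even (length (filter (\<lambda>x. x \<noteq> 0) w))" and sub: "set w \<subseteq> {..d}"
          by blast+
        from w ev show ?thesis
          by (cases rule: even_words_weight_le_5)
            (use sub c_sum in \<open>simp_all add: expected_coeff_scalar two four exp_generator_scalar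
              exp_generator_2 exp_generator_4 Suc_le_eq\<close>)
      qed
    qed
  qed
  finally show ?thesis
    unfolding sign_parametrization_iff[OF c_sum] by (simp add: generator_def)
qed

end
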